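(* Let $ABCD$ be a quadrilateral with isoptic point $W$ and Simson point $S$. The isogonal conjugate of $W$ with respect to $ABCD$ is a parallelogram. The isogonal conjugate of $S$ with respect to $ABCD$ is the degenerate quadrilateral whose four vertices coincide at infinity.
   Context: Quadrilaterals are nondegenerate. $(XYZ)$ denotes the circle through $X,Y,Z$. Isogonal conjugation with respect to $ABCD$: let $P$ be a point on the plane of $ABCD$, and let $l_A,l_B,l_C,l_D$ be the reflections of the lines $AP,BP,CP,DP$ in the bisectors of $\angle A,\angle B,\angle C,\angle D$ of the quadrilateral, respectively. Put $P_A=l_A\cap l_B$, $P_B=l_B\cap l_C$, $P_C=l_C\cap l_D$, $P_D=l_D\cap l_A$. The quadrilateral $P_AP_BP_CP_D$ is the isogonal conjugate of $P$ with respect to $ABCD$, denoted $Iso_{ABCD}(P)$. For circles $o,o'$ with centers $O,O'$ and radii $R,R'$, the circle of similitude $CS(o,o')$ is the set of points $P$ with $|PO|/|PO'|=R/R'$ (a line if $R=R'$). Let $o_1=(DAB)$, $o_2=(ABC)$, $o_3=(BCD)$, $o_4=(CDA)$ be the triad circles. If $ABCD$ is noncyclic, $W$ is the common point of all the circles of similitude $CS(o_i,o_j)$, $i\neq j$ (equivalently, the point of intersection of $CS(o_1,o_2)$ and $CS(o_1,o_4)$ other than $A$), and the Simson point $S$ is the second point of intersection of $CS(o_1,o_3)$ and $CS(o_2,o_4)$, so that $CS(o_1,o_3)\cap CS(o_2,o_4)=\{W,S\}$. If $ABCD$ is cyclic with circumcenter $O$, then $W=O$ and $S$ is the second point of intersection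 of the circles $(BOD)$ and $(AOC)$, $S\neq W$. The Simson point is the unique point for which the feet of the perpendiculars dropped to the sides of the quadrilateral lie on a line.
   Formalization: The parallelogram may be degenerate when opposite sides lie on one line (e.g. kites); coinciding lines are taken to meet at their point at infinity (trapezoids); crossed quadrilaterals with AC parallel to BD are excluded, since there the conjugate of W lies at infinity. *)

theory Defs
  imports "HOL-Analysis.Analysis"
begin

section \<open>Lines and their points at infinity\<close>

text \<open>The Euclidean plane is the type \<^typ>\<open>complex\<close>. Lines are point sets. The direction of a line
  is the one-dimensional subspace parallel to it, and serves as its point at infinity.\<close>

definition line :: "complex \<Rightarrow> complex \<Rightarrow> complex set" where
  "line X Y = affine hull {X, Y}"

definition direction :: "complex set \<Rightarrow> complex set" where
  "direction l = {X - Y | X Y. X \<in> l \<and> Y \<in> l}"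

definition parallel :: "complex set \<Rightarrow> complex set \<Rightarrow> bool" where
  "parallel l m \<longleftrightarrow> direction l = direction m"

datatype proj_point = Affine complex | Infinite "complex set"

definition proj_line :: "complex set \<Rightarrow> proj_point set" where
  "proj_line l = Affine ` l \<union> {Infinite (direction l)}"

text \<open>Two distinct lines have exactly one common point in the projective plane. Coinciding lines
  are treated like other parallel lines: they meet at their point at infinity. This matters for trapezoids \<open>A B C D\<close> with
  \<open>A B\<close> parallel to \<open>C D\<close>: the Simson point is the intersection of \<open>A D\<close> and \<open>B C\<close>, and its
  isogonal lines at \<open>A\<close> and \<open>B\<close> both coincide with \<open>A B\<close>.\<close>

definition meet :: "complex set \<Rightarrow> complex set \<Rightarrow> proj_point" where
  "meet l m = (if l = m then Infinite (direction l) else the_elem (proj_line l \<inter> proj_line m))"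

section \<open>Quadrilaterals\<close>

text \<open>Self-intersecting quadrilaterals are admitted unless their diagonals are parallel. For every
  simple quadrilateral (convex or not) the last condition is automatic, as shown in
  \<open>simple_imp_nondegenerate\<close> below. In a self-intersecting quadrilateral with parallel diagonals
  the points \<open>W\<close> and \<open>S\<close> collapse into one, whose isogonal conjugate is not a parallelogram.\<close>

definition nondegenerate_quadrilateral ::
    "complex \<Rightarrow> complex \<Rightarrow> complex \<Rightarrow> complex \<Rightarrow> bool" where
  "nondegenerate_quadrilateral A B C D \<longleftrightarrow>
     \<not> collinear {A, B, C} \<and> \<not> collinear {B, C, D} \<and>
     \<not> collinear {C, D, A} \<and> \<not> collinear {D, A, B} \<and>
     \<not> parallel (line A C) (line B D)"

lemma direction_line: "direction (line X Y) = range (\<lambda>t. t *\<^sub>R (Y - X))"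
proof -
  have l: "line X Y = range (\<lambda>t. X + t *\<^sub>R (Y - X))"
    unfolding line_def affine_hull_2_alt by auto
  show ?thesis
  proof (intro equalityI subsetI)
    fix v assume "v \<in> direction (line X Y)"
    then obtain s t where "v = (X + s *\<^sub>R (Y - X)) - (X + t *\<^sub>R (Y - X))"
      unfolding direction_def l by auto
    then have "v = (s - t) *\<^sub>R (Y - X)"
      by (simp add: scaleR_left_diff_distrib)
    then show "v \<in> range (\<lambda>t. t *\<^sub>R (Y - X))" by blast
  next
    fix v assume "v \<in> range (\<lambda>t. t *\<^sub>R (Y - X))"
    then obtain t where "v = (X + t *\<^sub>R (Y - X)) - (X + 0 *\<^sub>R (Y - X))" by auto
    then show "v \<in> direction (line X Y)"
      unfolding direction_def l by blast
  qed
qed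

lemma simple_imp_nondegenerate:
  assumes "\<not> collinear {A, B, C}" "\<not> collinear {B, C, D}"
    and "\<not> collinear {C, D, A}" "\<not> collinear {D, A, B}"
    and AB_CD: "closed_segment A B \<inter> closed_segment C D = {}"
    and BC_DA: "closed_segment B C \<inter> closed_segment D A = {}"
  shows "nondegenerate_quadrilateral A B C D"
proof -
  have "\<not> parallel (line A C) (line B D)"
  proof
    assume "parallel (line A C) (line B D)"
    then have "D - B \<in> range (\<lambda>t. t *\<^sub>R (C - A))"
      unfolding parallel_def direction_line by (metis rangeI scaleR_one)
    then obtain k where k: "D = B + k *\<^sub>R (C - A)"
      by (auto simp: algebra_simps)
    have "\<exists>P. P \<in> closed_segment X Y \<and> P \<in> closed_segment Z T"
      if "0 \<le> m" "X + m *\<^sub>R Y = T + m *\<^sub>R Z" for m :: real and X Y Z T :: complex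
    proof (intro exI conjI)
      have c: "1 - m / (1 + m) = 1 / (1 + m)" "1 - 1 / (1 + m) = m / (1 + m)"
        and m: "0 \<le> m / (1 + m)" "m / (1 + m) \<le> 1"
        and n: "0 \<le> 1 / (1 + m)" "1 / (1 + m) \<le> 1"
        using that(1) by (auto simp: field_simps)
      have "(1 / (1 + m)) *\<^sub>R (X + m *\<^sub>R Y) =
          (1 - m / (1 + m)) *\<^sub>R X + (m / (1 + m)) *\<^sub>R Y"
        unfolding c by (simp add: scaleR_right_distrib)
      with m show "(1 / (1 + m)) *\<^sub>R (X + m *\<^sub>R Y) \<in> closed_segment X Y"
        unfolding in_segment by blast
      have "(1 / (1 + m)) *\<^sub>R (T + m *\<^sub>R Z) =
          (1 - 1 / (1 + m)) *\<^sub>R Z + (1 / (1 + m)) *\<^sub>R T"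
        unfolding c by (simp add: scaleR_right_distrib)
      with n show "(1 / (1 + m)) *\<^sub>R (X + m *\<^sub>R Y) \<in> closed_segment Z T"
        unfolding in_segment that(2) by blast
    qed note * = this
    show False
    proof (cases "0 \<le> k")
      case True
      have "B + k *\<^sub>R C = D + k *\<^sub>R A"
        using k by (simp add: algebra_simps)
      with *[OF True this] BC_DA show False
        by (auto simp: closed_segment_commute)
    next
      case False
      have "B + (-k) *\<^sub>R A = D + (-k) *\<^sub>R C"
        using k by (simp add: algebra_simps)
      with *[OF _ this] False AB_CD show False
        by (auto simp: closed_segment_commute)
    qed
  qed
  with assms show ?thesis
    unfolding nondegenerate_quadrilateral_def by blast
qed

definition cyclic_quadrilateral ::
    "complex \<Rightarrow> complex \<Rightarrow> complex \<Rightarrow> complex \<Rightarrow> bool" where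
  "cyclic_quadrilateral A B C D \<longleftrightarrow> (\<exists>Z r. {A, B, C, D} \<subseteq> sphere Z r)"

section \<open>Isogonal conjugation\<close>

definition reflection :: "complex set \<Rightarrow> complex \<Rightarrow> complex" where
  "reflection l P = 2 *\<^sub>R closest_point l P - P"

text \<open>The bisector of the angle \<open>X V Y\<close>, as a full line. It is also the bisector of the
  complementary reflex angle, which is the interior one at a nonconvex vertex.\<close>

definition angle_bisector :: "complex \<Rightarrow> complex \<Rightarrow> complex \<Rightarrow> complex set" where
  "angle_bisector X V Y = range (\<lambda>t. V + t *\<^sub>R (sgn (X - V) + sgn (Y - V)))"

definition isogonal_line ::
    "complex \<Rightarrow> complex \<Rightarrow> complex \<Rightarrow> complex \<Rightarrow> complex set" where
  "isogonal_line X V Y P = reflection (angle_bisector X V Y) ` line V P"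

definition Iso ::
    "complex \<Rightarrow> complex \<Rightarrow> complex \<Rightarrow> complex \<Rightarrow> complex \<Rightarrow>
     proj_point \<times> proj_point \<times> proj_point \<times> proj_point" where
  "Iso A B C D P =
     (let lA = isogonal_line D A B P; lB = isogonal_line A B C P;
          lC = isogonal_line B C D P; lD = isogonal_line C D A P
      in (meet lA lB, meet lB lC, meet lC lD, meet lD lA))"

text \<open>The sides of the isogonal conjugate lie on \<open>lB\<close>, \<open>lC\<close>, \<open>lD\<close>, \<open>lA\<close> in this order. It is a
  parallelogram if its vertices are finite, opposite sides lie on parallel lines, and as vectors
  they are equal. The parallelogram collapses exactly if two opposite side lines coincide, and
  this does occur: if \<open>A B C D\<close> is a kite with axis \<open>A C\<close>, then the isoptic point is on \<open>A C\<close>,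
  so \<open>lA = lC\<close>. In all other cases the vertices are required to be non-collinear.\<close>

definition Iso_is_parallelogram ::
    "complex \<Rightarrow> complex \<Rightarrow> complex \<Rightarrow> complex \<Rightarrow> complex \<Rightarrow> bool" where
  "Iso_is_parallelogram A B C D P \<longleftrightarrow>
     (let lA = isogonal_line D A B P; lB = isogonal_line A B C P;
          lC = isogonal_line B C D P; lD = isogonal_line C D A P
      in \<exists>PA PB PC PD.
           Iso A B C D P = (Affine PA, Affine PB, Affine PC, Affine PD) \<and>
           parallel lA lC \<and> parallel lB lD \<and>
           PB - PA = PC - PD \<and>
           (lA \<noteq> lC \<and> lB \<noteq> lD \<longrightarrow> \<not> collinear {PA, PB, PC}))"

section \<open>The isoptic point and the Simson point\<close>

text \<open>A circle is represented by its center and radius.\<close>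

definition circumcenter :: "complex \<Rightarrow> complex \<Rightarrow> complex \<Rightarrow> complex" where
  "circumcenter X Y Z = (THE Q. dist Q X = dist Q Y \<and> dist Q Y = dist Q Z)"

definition circumcircle :: "complex \<Rightarrow> complex \<Rightarrow> complex \<Rightarrow> complex \<times> real" where
  "circumcircle X Y Z = (circumcenter X Y Z, dist (circumcenter X Y Z) X)"

definition CS :: "complex \<times> real \<Rightarrow> complex \<times> real \<Rightarrow> complex set" where
  "CS k k' = {P. dist P (fst k) / dist P (fst k') = snd k / snd k'}"

definition triad_circles ::
    "complex \<Rightarrow> complex \<Rightarrow> complex \<Rightarrow> complex \<Rightarrow> (complex \<times> real) set" where
  "triad_circles A B C D =
     {circumcircle D A B, circumcircle A B C, circumcircle B C D, circumcircle C D A}"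

definition isoptic_point ::
    "complex \<Rightarrow> complex \<Rightarrow> complex \<Rightarrow> complex \<Rightarrow> complex \<Rightarrow> bool" where
  "isoptic_point A B C D W \<longleftrightarrow>
     (if cyclic_quadrilateral A B C D then W = circumcenter A B C
      else \<forall>k \<in> triad_circles A B C D. \<forall>k' \<in> triad_circles A B C D. k \<noteq> k' \<longrightarrow> W \<in> CS k k')"

text \<open>The circle \<open>(X Y Z)\<close> as a point set. If a diagonal of a cyclic quadrilateral is a diameter,
  its end points are collinear with the circumcenter, and the circle degenerates to a line.\<close>

definition circle_through :: "complex \<Rightarrow> complex \<Rightarrow> complex \<Rightarrow> complex set" where
  "circle_through X Y Z =
     (if collinear {X, Y, Z} then affine hull {X, Y, Z}
      else sphere (fst (circumcircle X Y Z)) (snd (circumcircle X Y Z)))"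

text \<open>The clause \<open>\<not> isoptic_point A B C D S\<close> says \<open>S \<noteq> W\<close>. In this form it also covers
  noncyclic quadrilaterals whose isoptic point is at infinity.\<close>

definition Simson_point ::
    "complex \<Rightarrow> complex \<Rightarrow> complex \<Rightarrow> complex \<Rightarrow> complex \<Rightarrow> bool" where
  "Simson_point A B C D S \<longleftrightarrow>
     \<not> isoptic_point A B C D S \<and>
     (if cyclic_quadrilateral A B C D
      then S \<in> circle_through B (circumcenter A B C) D \<inter> circle_through A (circumcenter A B C) C
      else S \<in> CS (circumcircle D A B) (circumcircle B C D) \<inter>
               CS (circumcircle A B C) (circumcircle C D A))"

end

theory Submission
  imports Defs
begin

text \<open>Take complex coordinates with the origin at the point \<open>P\<close> whose isogonal conjugate is formed, and let
\<open>a\<close>, \<open>b\<close>, \<open>c\<close>, \<open>d\<close> be the vertices. The bisector at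
\<open>A\<close> has a direction whose square is a positive multiple of \<open>(b - a) (d - a)\<close>, so the
isogonal line at \<open>A\<close> has direction \<open>(b - a) (d - a) / a\<close>, and likewise at the other
vertices (\<open>isogonal_line_eq\<close>). The whole statement thus becomes one about quotients of such directions
being real or not.

Let \<open>X\<close> and \<open>Y\<close> be two of the vertices and \<open>Z\<close>, \<open>T\<close> the other
two. The quotient of the two directions at \<open>X\<close> and \<open>Y\<close>, formed with \<open>Z\<close> and
\<open>T\<close> as the neighbours of both, is real if and only if \<open>\<angle>XPY = \<angle>XZY +
\<angle>XTY\<close> as directed angles modulo \<open>\<pi>\<close>; this relation is called \<open>angle_sum P X Y
Z T\<close>. For the diagonals \<open>A C\<close> and \<open>B D\<close> it says that opposite isogonal lines are
parallel. It also characterizes circles of similitude: two distinct circles \<open>(X Y Z)\<close> and \<open>(X Y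
T)\<close> have as circle of similitude the locus of \<open>P\<close> with this angle sum
(\<open>CS_iff_angle_sum\<close>), because the power of \<open>P\<close> divided by the squared radius depends only
on the chord \<open>X Y\<close> and on the inscribed angle over it (\<open>power_of_point_over_chord\<close>). If
the quadrilateral is cyclic, the inscribed angle theorem gives the same relation for the circumcenter and for the
points of the circle through \<open>X\<close>, \<open>Y\<close> and the circumcenter. So both for the isoptic point
and for the Simson point opposite isogonal lines are parallel.

Adjacent sides distinguish the two. Given the angle sums over both diagonals, the algebraic identity behind
\<open>angle_sum_adjacent\<close> shows that either the angle sum over the side \<open>A B\<close> holds too, or
\<open>a c = b d\<close>. The isoptic point is exactly the first alternative. There the quotient of the isogonal
directions at \<open>A\<close> and \<open>B\<close> is a real multiple of \<open>(b - d) / (a - c)\<close>, which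
is not real since the diagonals are not parallel; two pairs of parallel lines with different directions bound a
parallelogram. The Simson point is the second alternative, the Miquel point of the four side lines. There \<open>(b
- a) (d - a) = a (a + c - b - d)\<close>, and similarly at the other vertices, so all four isogonal lines have the
direction \<open>a + c - b - d\<close> and meet at one point at infinity.\<close>

section \<open>Lines given by a point and a direction\<close>

lemma collinear_iff_quotient_real:
  "collinear {X, Y, Z} \<longleftrightarrow> (Z - Y) / (X - Y) \<in> \<real>" for X Y Z :: complex
proof -
  have "collinear {X, Y, Z} \<longleftrightarrow> collinear {0, X - Y, Z - Y}"
    by (simp add: collinear_3 del: minus_diff_eq)
  then show ?thesis
    by (simp add: collinear_iff_Reals)
qed

lemma quotient_realE:
  fixes u v :: complex
  assumes "u / v \<in> \<real>" "v \<noteq> 0"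
  obtains r :: real where "u = r *\<^sub>R v"
  using assms by (metis Reals_cases nonzero_eq_divide_eq scaleR_conv_of_real)

definition line_along :: "complex \<Rightarrow> complex \<Rightarrow> complex set" where
  "line_along V u = range (\<lambda>t::real. V + t *\<^sub>R u)"

lemma line_eq_line_along: "line V P = line_along V (P - V)"
  unfolding line_def line_along_def affine_hull_2_alt ..

lemma direction_line_along: "direction (line_along V u) = range (\<lambda>t::real. t *\<^sub>R u)"
proof -
  have "line_along V u = line V (V + u)"
    by (simp add: line_eq_line_along)
  then show ?thesis
    by (simp add: direction_line)
qed

lemma range_scaleR_subset:
  fixes u v :: complex
  assumes "u = r *\<^sub>R v"
  shows "range (\<lambda>t::real. t *\<^sub>R u) \<subseteq> range (\<lambda>t::real. t *\<^sub>R v)"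
  using assms by (auto simp: image_def)

lemma parallel_line_along:
  assumes "u \<noteq> 0" "v \<noteq> 0"
  shows "parallel (line_along V u) (line_along W v) \<longleftrightarrow> u / v \<in> \<real>"
proof
  assume "parallel (line_along V u) (line_along W v)"
  then have "range (\<lambda>t::real. t *\<^sub>R u) = range (\<lambda>t::real. t *\<^sub>R v)"
    by (simp add: parallel_def direction_line_along)
  then have "u \<in> range (\<lambda>t::real. t *\<^sub>R v)"
    by (metis rangeI scaleR_one)
  then show "u / v \<in> \<real>"
    using assms by (auto simp: scaleR_conv_of_real)
next
  assume "u / v \<in> \<real>"
  then obtain r where r: "u = r *\<^sub>R v"
    using assms(2) by (rule quotient_realE)
  then have "v = inverse r *\<^sub>R u"
    using assms by auto
  with r show "parallel (line_along V u) (line_along W v)"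
    unfolding parallel_def direction_line_along
    using range_scaleR_subset by blast
qed

lemma line_along_diff:
  assumes "X \<in> line_along V u" "Y \<in> line_along V u"
  obtains t :: real where "X - Y = t *\<^sub>R u"
proof -
  have "X - Y \<in> direction (line_along V u)"
    using assms by (auto simp: direction_def)
  then show thesis
    using that by (auto simp: direction_line_along)
qed

lemma line_along_eqI:
  assumes "Q \<in> line_along V u" "Q \<in> line_along W v"
    and "parallel (line_along V u) (line_along W v)"
  shows "line_along V u = line_along W v"
proof -
  have *: "line_along V u = (+) Q ` direction (line_along V u)"
    if "Q \<in> line_along V u" for V u
  proof -
    from that obtain s where s: "Q = V + s *\<^sub>R u"
      by (auto simp: line_along_def)
    show ?thesis
    proof (intro equalityI subsetI)
      fix x assume "x \<in> line_along V u"
      then obtain t where "x = V + t *\<^sub>R u"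
        by (auto simp: line_along_def)
      then have "x = Q + (t - s) *\<^sub>R u"
        using s by (simp add: algebra_simps)
      then show "x \<in> (+) Q ` direction (line_along V u)"
        unfolding direction_line_along by blast
    next
      fix x assume "x \<in> (+) Q ` direction (line_along V u)"
      then obtain t where "x = Q + t *\<^sub>R u"
        unfolding direction_line_along by blast
      then have "x = V + (s + t) *\<^sub>R u"
        using s by (simp add: algebra_simps)
      then show "x \<in> line_along V u"
        unfolding line_along_def by blast
    qed
  qed
  from *[OF assms(1)] *[OF assms(2)] assms(3) show ?thesis
    by (simp add: parallel_def)
qed

lemma scaleR_eq_imp_zero:
  fixes u v :: complex
  assumes "u / v \<notin> \<real>" "a *\<^sub>R u = b *\<^sub>R v"
  shows "a = 0" "b = 0"
proof -
  have "v \<noteq> 0" using assms(1) by auto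
  show "a = 0"
  proof (rule ccontr)
    assume "a \<noteq> 0"
    then have "u / v = of_real (b / a)"
      using assms(2) \<open>v \<noteq> 0\<close> by (simp add: scaleR_conv_of_real field_simps)
    with assms(1) show False
      by (metis Reals_of_real)
  qed
  with assms(2) \<open>v \<noteq> 0\<close> show "b = 0" by simp
qed

lemma meet_parallel:
  assumes "parallel (line_along V u) (line_along W v)"
  shows "meet (line_along V u) (line_along W v) = Infinite (direction (line_along V u))"
proof (cases "line_along V u = line_along W v")
  case True
  then show ?thesis by (simp add: meet_def)
next
  case False
  then have "line_along V u \<inter> line_along W v = {}"
    using line_along_eqI assms by blast
  then have "proj_line (line_along V u) \<inter> proj_line (line_along W v) =
      {Infinite (direction (line_along V u))}"
    using assms by (auto simp: proj_line_def parallel_def)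
  then show ?thesis
    using False by (simp add: meet_def)
qed

lemma meet_nonparallel:
  assumes "u / v \<notin> \<real>"
  shows "\<exists>Q. meet (line_along V u) (line_along W v) = Affine Q \<and>
    Q \<in> line_along V u \<and> Q \<in> line_along W v"
proof -
  have nz: "u \<noteq> 0" "v \<noteq> 0"
    using assms by auto
  then have np: "\<not> parallel (line_along V u) (line_along W v)"
    using assms by (simp add: parallel_line_along)
  have "u * cnj v \<notin> \<real>"
  proof
    assume "u * cnj v \<in> \<real>"
    moreover have "u / v = (u * cnj v) / (v * cnj v)"
      using nz by simp
    moreover have "v * cnj v \<in> \<real>"
      by (metis complex_mult_cnj Reals_of_real)
    ultimately show False
      using assms by (metis Reals_divide)
  qed
  then have D: "Im (u * cnj v) \<noteq> 0"
    by (simp add: complex_is_Real_iff)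
  \<comment> \<open>Cramer's rule for \<open>V + t u = W + s v\<close>.\<close>
  define t where "t = Im ((W - V) * cnj v) / Im (u * cnj v)"
  define s where "s = Im ((W - V) * cnj u) / Im (u * cnj v)"
  define Q where "Q = V + t *\<^sub>R u"
  have "Q = W + s *\<^sub>R v"
    unfolding Q_def t_def s_def using D by (simp add: complex_eq_iff field_simps)
  then have Q: "Q \<in> line_along V u" "Q \<in> line_along W v"
    by (metis Q_def line_along_def rangeI, metis line_along_def rangeI)
  have "x = Q" if x: "x \<in> line_along V u" "x \<in> line_along W v" for x
  proof (rule ccontr)
    assume "x \<noteq> Q"
    obtain t' where t': "x = V + t' *\<^sub>R u"
      using x(1) by (auto simp: line_along_def)
    obtain s' where s': "x = W + s' *\<^sub>R v"
      using x(2) by (auto simp: line_along_def)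
    have e: "(t' - t) *\<^sub>R u = (s' - s) *\<^sub>R v"
    proof -
      have "(t' - t) *\<^sub>R u = x - Q"
        by (simp add: t' Q_def algebra_simps)
      also have "\<dots> = (s' - s) *\<^sub>R v"
        by (simp add: s' \<open>Q = W + s *\<^sub>R v\<close> algebra_simps)
      finally show ?thesis .
    qed
    have "t' - t \<noteq> 0"
      using \<open>x \<noteq> Q\<close> t' Q_def by auto
    then have "u = inverse (t' - t) *\<^sub>R ((t' - t) *\<^sub>R u)"
      by simp
    also have "\<dots> = (inverse (t' - t) * (s' - s)) *\<^sub>R v"
      by (simp only: e scaleR_scaleR)
    finally have "u = (inverse (t' - t) * (s' - s)) *\<^sub>R v" .
    then have "u / v \<in> \<real>"
      using nz by (simp add: scaleR_conv_of_real)
    with assms show False by simp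
  qed
  with Q have "line_along V u \<inter> line_along W v = {Q}"
    by blast
  then have "proj_line (line_along V u) \<inter> proj_line (line_along W v) = {Affine Q}"
    using np by (auto simp: proj_line_def parallel_def)
  moreover have "line_along V u \<noteq> line_along W v"
    using np by (auto simp: parallel_def)
  ultimately show ?thesis
    using Q by (auto simp: meet_def)
qed

text \<open>Opposite sides of the resulting figure lie on parallel lines, and comparing the two ways from the first vertex to
the third gives a vector that is a multiple of both directions, hence zero. The equality of opposite sides
therefore survives when two opposite lines coincide; only the noncollinearity has to exclude that case.\<close>

lemma parallel_line_pairs_meet:
  fixes VA VB VC VD u v u' v' :: complex
  defines "lA \<equiv> line_along VA u" and "lB \<equiv> line_along VB v"
    and "lC \<equiv> line_along VC u'" and "lD \<equiv> line_along VD v'"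
  assumes "u / u' \<in> \<real>" "v / v' \<in> \<real>" "u / v \<notin> \<real>" "u' \<noteq> 0" "v' \<noteq> 0"
  shows "\<exists>PA PB PC PD.
    meet lA lB = Affine PA \<and> meet lB lC = Affine PB \<and>
    meet lC lD = Affine PC \<and> meet lD lA = Affine PD \<and>
    parallel lA lC \<and> parallel lB lD \<and> PB - PA = PC - PD \<and>
    (lA \<noteq> lC \<and> lB \<noteq> lD \<longrightarrow> \<not> collinear {PA, PB, PC})"
proof -
  have nz: "u \<noteq> 0" "v \<noteq> 0"
    using assms(7) by auto
  have par: "parallel lA lC" "parallel lB lD"
    using assms nz by (simp_all add: parallel_line_along)
  have nonpar: "v / u' \<notin> \<real>" "u' / v' \<notin> \<real>" "v' / u \<notin> \<real>"
  proof -
    have "u / v = (u / u') / (v / u')" "u / v = (u / u') * (u' / v') / (v / v')"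
      "u / v = inverse (v' / u) / (v / v')"
      using assms nz by (simp_all add: field_simps)
    then show "v / u' \<notin> \<real>" "u' / v' \<notin> \<real>" "v' / u \<notin> \<real>"
      using assms(5-7) by (metis Reals_divide Reals_mult Reals_inverse)+
  qed
  obtain PA where PA: "meet lA lB = Affine PA" "PA \<in> lA" "PA \<in> lB"
    using meet_nonparallel[OF assms(7), of VA VB] by (auto simp: assms(1-4))
  obtain PB where PB: "meet lB lC = Affine PB" "PB \<in> lB" "PB \<in> lC"
    using meet_nonparallel[OF nonpar(1), of VB VC] by (auto simp: assms(1-4))
  obtain PC where PC: "meet lC lD = Affine PC" "PC \<in> lC" "PC \<in> lD"
    using meet_nonparallel[OF nonpar(2), of VC VD] by (auto simp: assms(1-4))
  obtain PD where PD: "meet lD lA = Affine PD" "PD \<in> lD" "PD \<in> lA"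
    using meet_nonparallel[OF nonpar(3), of VD VA] by (auto simp: assms(1-4))
  obtain r where r: "u = r *\<^sub>R u'"
    using assms(5,8) by (rule quotient_realE)
  obtain s where s: "v = s *\<^sub>R v'"
    using assms(6,9) by (rule quotient_realE)
  have rs: "u' = inverse r *\<^sub>R u" "v' = inverse s *\<^sub>R v"
    using r s nz by auto
  obtain a where a: "PB - PA = a *\<^sub>R v"
    using PA(3) PB(2) unfolding assms(1-4) by (metis line_along_diff)
  obtain b where "PC - PB = b *\<^sub>R u'"
    using PC(2) PB(3) unfolding assms(1-4) by (metis line_along_diff)
  then have b: "PC - PB = (b * inverse r) *\<^sub>R u"
    by (simp add: rs(1))
  obtain c where "PC - PD = c *\<^sub>R v'"
    using PC(3) PD(2) unfolding assms(1-4) by (metis line_along_diff)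
  then have c: "PC - PD = (c * inverse s) *\<^sub>R v"
    by (simp add: rs(2))
  obtain d where d: "PD - PA = d *\<^sub>R u"
    using PA(2) PD(3) unfolding assms(1-4) by (metis line_along_diff)
  have "(d - b * inverse r) *\<^sub>R u = (PD - PA) - (PC - PB)"
    by (simp only: b d scaleR_left_diff_distrib)
  also have "\<dots> = (PB - PA) - (PC - PD)"
    by simp
  also have "\<dots> = (a - c * inverse s) *\<^sub>R v"
    by (simp only: a c scaleR_left_diff_distrib)
  finally have "a - c * inverse s = 0"
    by (rule scaleR_eq_imp_zero[OF assms(7)])
  then have eq: "PB - PA = PC - PD"
    using a c by simp
  have "\<not> collinear {PA, PB, PC}" if ne: "lA \<noteq> lC" "lB \<noteq> lD"
  proof
    assume "collinear {PA, PB, PC}"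
    then have real: "(PC - PB) / (PA - PB) \<in> \<real>"
      by (simp only: collinear_iff_quotient_real)
    have "PA \<noteq> PB"
      using line_along_eqI[of PA VA u VC u'] PA PB par ne by (auto simp: assms(1-4))
    moreover have "PB \<noteq> PC"
      using line_along_eqI[of PB VB v VD v'] PB PC par ne by (auto simp: assms(1-4))
    ultimately obtain t where t: "PC - PB = t *\<^sub>R (PA - PB)" "t \<noteq> 0"
      using real quotient_realE[of "PC - PB" "PA - PB"]
      by (metis eq_iff_diff_eq_0 scaleR_zero_left)
    then have "(b * inverse r) *\<^sub>R u = (- t * a) *\<^sub>R v"
      using a b by (metis minus_diff_eq mult_minus_left scaleR_minus_left scaleR_minus_right scaleR_scaleR)
    then have "b * inverse r = 0"
      by (rule scaleR_eq_imp_zero[OF assms(7)])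
    with b \<open>PB \<noteq> PC\<close> show False by simp
  qed
  with PA(1) PB(1) PC(1) PD(1) par eq show ?thesis by blast
qed

section \<open>Isogonal lines and sums of angles\<close>

text \<open>The argument of this number is the sum of the directions of the two sides at \<open>V\<close> minus that of
\<open>V P\<close>: reflecting in the bisector turns the direction of \<open>V P\<close> into it.\<close>

definition isogonal_dir :: "complex \<Rightarrow> complex \<Rightarrow> complex \<Rightarrow> complex \<Rightarrow> complex" where
  "isogonal_dir X V Y P = (X - V) * (Y - V) / (P - V)"

lemma isogonal_dir_commute: "isogonal_dir X V Y P = isogonal_dir Y V X P"
  by (simp add: isogonal_dir_def mult.commute)

text \<open>Reflection in the real line is \<open>cnj\<close>; conjugating it with the rotation that takes the real line to the
direction \<open>b\<close> produces the unimodular factor \<open>b / cnj b\<close>.\<close>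

lemma reflection_line_along:
  assumes "b \<noteq> 0"
  shows "reflection (line_along V b) (V + p) = V + b / cnj b * cnj p"
proof -
  define c where "c = (p \<bullet> b) / (b \<bullet> b)"
  have bb: "b \<bullet> b \<noteq> 0"
    using assms by simp
  have aff: "affine (line_along V b)"
  proof -
    have "line_along V b = line V (V + b)"
      by (simp add: line_eq_line_along)
    then show ?thesis
      by (simp add: line_def)
  qed
  have "V + c *\<^sub>R b = closest_point (line_along V b) (V + p)"
  proof (rule closest_point_unique)
    show "convex (line_along V b)" "closed (line_along V b)"
      using aff affine_imp_convex affine_closed by auto
    show "V + c *\<^sub>R b \<in> line_along V b"
      by (auto simp: line_along_def)
    show "\<forall>z\<in>line_along V b. dist (V + p) (V + c *\<^sub>R b) \<le> dist (V + p) z"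
    proof
      fix z assume "z \<in> line_along V b"
      then obtain t where z: "z = V + t *\<^sub>R b"
        by (auto simp: line_along_def)
      have "(p - c *\<^sub>R b) \<bullet> b = 0"
        using bb by (simp add: c_def inner_diff_left)
      then have "orthogonal (p - c *\<^sub>R b) ((c - t) *\<^sub>R b)"
        by (simp add: orthogonal_def)
      then have "(norm (p - c *\<^sub>R b + (c - t) *\<^sub>R b))\<^sup>2 =
          (norm (p - c *\<^sub>R b))\<^sup>2 + (norm ((c - t) *\<^sub>R b))\<^sup>2"
        by (rule norm_add_Pythagorean)
      then have "(norm (p - c *\<^sub>R b))\<^sup>2 \<le> (norm (p - t *\<^sub>R b))\<^sup>2"
        by (simp add: algebra_simps)
      then show "dist (V + p) (V + c *\<^sub>R b) \<le> dist (V + p) z"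
        by (simp add: z dist_norm power2_le_iff_abs_le)
    qed
  qed
  then have "reflection (line_along V b) (V + p) = V + (2 * c) *\<^sub>R b - p"
    unfolding reflection_def by (metis (no_types, lifting) add.commute add_diff_eq diff_add_eq
        diff_diff_add mult_2 scaleR_2 scaleR_left_distrib scaleR_right_distrib add_diff_cancel_left
        scaleR_scaleR add.assoc)
  also have "(2 * c) *\<^sub>R b = p + b / cnj b * cnj p"
  proof -
    have "of_real (b \<bullet> b) = b * cnj b" "of_real (2 * (p \<bullet> b)) = p * cnj b + cnj p * b"
      by (simp_all add: complex_eq_iff inner_complex_def algebra_simps)
    then have "of_real (2 * c) = (p * cnj b + cnj p * b) / (b * cnj b)"
      by (simp add: c_def)
    then show ?thesis
      using assms by (simp add: scaleR_conv_of_real field_simps)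
  qed
  finally show ?thesis by simp
qed

text \<open>The bisecting direction \<open>x + y\<close> of two unit vectors has a phase whose square is \<open>x * y\<close>.\<close>

lemma sum_units_div_cnj:
  fixes x y :: complex
  assumes "norm x = 1" "norm y = 1" "x + y \<noteq> 0"
  shows "(x + y) / cnj (x + y) = x * y"
proof -
  have "x * cnj x = 1" "y * cnj y = 1"
    using assms by (simp_all add: complex_norm_square[symmetric])
  then have "x * y * cnj (x + y) = x + y"
    by (simp add: algebra_simps)
  then show ?thesis
    using assms(3) by (metis complex_cnj_zero_iff nonzero_eq_divide_eq)
qed

text \<open>With unit vectors \<open>x\<close>, \<open>y\<close> along the sides, the reflection multiplies the conjugate of
\<open>P - V\<close> by \<open>x * y\<close>, and that conjugate is a positive multiple of \<open>1 / (P -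
V)\<close>.\<close>

lemma isogonal_line_eq:
  assumes "\<not> collinear {X, V, Y}" "P \<noteq> V"
  shows "isogonal_line X V Y P = line_along V (isogonal_dir X V Y P)"
proof -
  define x y p where "x = X - V" and "y = Y - V" and "p = P - V"
  define b where "b = sgn x + sgn y"
  have q: "y / x \<notin> \<real>"
    using assms(1) by (simp add: collinear_iff_quotient_real x_def y_def)
  then have xy: "x \<noteq> 0" "y \<noteq> 0" and p: "p \<noteq> 0"
    using assms(2) by (auto simp: p_def)
  have "b \<noteq> 0"
  proof
    assume "b = 0"
    then have "sgn y = - sgn x"
      by (simp add: b_def eq_neg_iff_add_eq_0 add.commute)
    then have "y / of_real (norm y) = - (x / of_real (norm x))"
      by (simp add: sgn_eq)
    then have "y / x = - of_real (norm y / norm x)"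
      using xy by (simp add: field_simps)
    then have "y / x \<in> \<real>" by simp
    with q show False by simp
  qed
  have bis: "b / cnj b = sgn x * sgn y"
    unfolding b_def using \<open>b \<noteq> 0\<close> xy by (intro sum_units_div_cnj) (auto simp: norm_sgn b_def)
  define k where "k = (norm p)\<^sup>2 / (norm x * norm y)"
  have k: "k \<noteq> 0"
    using xy p by (simp add: k_def)
  have r: "reflection (line_along V b) (V + t *\<^sub>R p) = V + (t * k) *\<^sub>R (x * y / p)" for t
  proof -
    have "cnj p = of_real ((norm p)\<^sup>2) / p"
      using p by (metis complex_norm_square nonzero_mult_div_cancel_left)
    then have "sgn x * sgn y * cnj p = k *\<^sub>R (x * y / p)"
      using xy p by (simp add: sgn_eq k_def scaleR_conv_of_real)
    moreover have "b / cnj b * cnj (t *\<^sub>R p) = t *\<^sub>R (sgn x * sgn y * cnj p)"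
      unfolding bis by simp
    ultimately show ?thesis
      by (simp add: reflection_line_along[OF \<open>b \<noteq> 0\<close>])
  qed
  have "isogonal_line X V Y P = range (\<lambda>t. V + (t * k) *\<^sub>R (x * y / p))"
    unfolding isogonal_line_def angle_bisector_def line_eq_line_along
    unfolding x_def[symmetric] y_def[symmetric] p_def[symmetric] b_def[symmetric]
      line_along_def[of V b, symmetric] line_along_def[of V p] image_image r ..
  also have "\<dots> = (\<lambda>t. V + t *\<^sub>R (x * y / p)) ` range (\<lambda>t. t * k)"
    by (simp add: image_image)
  also have "range (\<lambda>t. t * k) = UNIV"
    using k by (auto simp: image_iff) (metis nonzero_divide_eq_eq)
  finally show ?thesis
    by (simp add: line_along_def isogonal_dir_def x_def y_def p_def)
qed

text \<open>The argument of the quotient is \<open>\<angle>XZY + \<angle>XTY - \<angle>XPY\<close>, so the condition says that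
the first two directed angles add up to the third modulo \<open>\<pi>\<close>. Equivalently, the line \<open>X
P\<close> reflected in the bisector of \<open>\<angle>ZXT\<close> and the line \<open>Y P\<close> reflected in the
bisector of \<open>\<angle>ZYT\<close> are parallel. Division by zero makes it hold trivially for \<open>P =
X\<close> and \<open>P = Y\<close>.\<close>

definition angle_sum :: "complex \<Rightarrow> complex \<Rightarrow> complex \<Rightarrow> complex \<Rightarrow> complex \<Rightarrow> bool" where
  "angle_sum P X Y Z T \<longleftrightarrow> isogonal_dir Z X T P / isogonal_dir Z Y T P \<in> \<real>"

lemma angle_sum_commute: "angle_sum P X Y Z T \<longleftrightarrow> angle_sum P X Y T Z"
  by (simp add: angle_sum_def isogonal_dir_commute)

text \<open>Let \<open>r\<close> and \<open>s\<close> be the two quotients whose reality is assumed. Both \<open>1 - r\<close>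
and \<open>1 - s\<close> contain the factor \<open>a c - b d\<close> (origin at \<open>P\<close>); it cancels, and
\<open>(1 - r) / (1 - s)\<close> is precisely the quotient for the side \<open>A B\<close>. The exceptional case
\<open>a c = b d\<close>, in which \<open>r = s = 1\<close>, is the Miquel point.\<close>

lemma angle_sum_adjacent:
  assumes "angle_sum P A C B D" "angle_sum P B D C A"
    and "(A - P) * (C - P) \<noteq> (B - P) * (D - P)"
    and "P \<noteq> A" "P \<noteq> B" "P \<noteq> C" "P \<noteq> D" "A \<noteq> D" "B \<noteq> C" "C \<noteq> D" "B \<noteq> D"
  shows "angle_sum P A B C D"
proof -
  define a b c d where "a = A - P" and "b = B - P" and "c = C - P" and "d = D - P"
  have dir: "isogonal_dir X V Y P = - ((X - P) - (V - P)) * ((Y - P) - (V - P)) / (V - P)" for X V Y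
    unfolding isogonal_dir_def by (metis (no_types, lifting) diff_diff_eq2 diff_add_cancel
      minus_diff_eq minus_divide_right minus_divide_left mult_minus_left)
  have nz: "a \<noteq> 0" "b \<noteq> 0" "c \<noteq> 0" "d \<noteq> 0" "a - d \<noteq> 0" "b - c \<noteq> 0" "c - d \<noteq> 0" "b - d \<noteq> 0" "a * c - b * d \<noteq> 0"
    using assms by (auto simp: a_def b_def c_def d_def)
  define r s where "r = isogonal_dir B A D P / isogonal_dir B C D P"
    and "s = isogonal_dir C B A P / isogonal_dir C D A P"
  have "r \<in> \<real>" "s \<in> \<real>"
    using assms(1,2) by (auto simp: angle_sum_def r_def s_def)
  have r: "1 - r = (a - c) * (b * d - a * c) / (a * (b - c) * (d - c))"
    and s: "1 - s = (b - d) * (a * c - b * d) / (b * (c - d) * (a - d))"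
    unfolding r_def s_def dir a_def[symmetric] b_def[symmetric] c_def[symmetric] d_def[symmetric]
    using nz by (simp_all add: divide_simps) (simp_all add: algebra_simps)
  have "isogonal_dir C A D P / isogonal_dir C B D P = (1 - r) / (1 - s)"
    unfolding r s unfolding dir a_def[symmetric] b_def[symmetric] c_def[symmetric] d_def[symmetric]
    using nz by (simp_all add: divide_simps) (simp add: algebra_simps)
  then show ?thesis
    using \<open>r \<in> \<real>\<close> \<open>s \<in> \<real>\<close> by (simp add: angle_sum_def)
qed

text \<open>Two points that see the segment \<open>X Y\<close> under the same directed angle modulo \<open>\<pi>\<close> lie
with \<open>X\<close> and \<open>Y\<close> on one circle or line.\<close>

lemma cross_ratio_real_of_angle_sums:
  assumes "angle_sum P X Y Z T" "angle_sum Q X Y Z T"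
    and "X \<noteq> Z" "X \<noteq> T" "Y \<noteq> Z" "Y \<noteq> T" "P \<notin> {X, Y}" "Q \<notin> {X, Y}"
  shows "(P - X) * (Q - Y) / ((P - Y) * (Q - X)) \<in> \<real>"
proof -
  have "(P - X) * (Q - Y) / ((P - Y) * (Q - X)) =
      (isogonal_dir Z X T Q / isogonal_dir Z Y T Q) / (isogonal_dir Z X T P / isogonal_dir Z Y T P)"
    using assms by (simp add: isogonal_dir_def divide_simps)
  then show ?thesis
    using assms by (metis Reals_divide angle_sum_def)
qed

section \<open>Circumcenters and inscribed angles\<close>

lemma mult_cnj_radius:
  assumes "dist Q X = r"
  shows "(X - Q) * cnj (X - Q) = of_real (r\<^sup>2)"
  using assms by (metis complex_norm_square dist_commute dist_norm)

text \<open>The inscribed angle theorem: a complex number divided by its conjugate has twice its argument, so this says that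
the central angle \<open>\<angle>XQY\<close> is twice the inscribed angle \<open>\<angle>XZY\<close>. It follows
from \<open>cnj z = r\<^sup>2 / z\<close> on the circle of radius \<open>r\<close> about \<open>0\<close>.\<close>

lemma inscribed_angle:
  fixes X Y Z Q :: complex
  assumes "dist Q X = r" "dist Q Y = r" "dist Q Z = r" "Z \<noteq> X" "Z \<noteq> Y"
  shows "cnj ((X - Z) / (Y - Z)) = (X - Z) / (Y - Z) * ((Y - Q) / (X - Q))"
proof -
  define x y z where "x = X - Q" and "y = Y - Q" and "z = Z - Q"
  have n: "x * cnj x = of_real (r\<^sup>2)" "y * cnj y = of_real (r\<^sup>2)" "z * cnj z = of_real (r\<^sup>2)"
    using assms(1-3) by (simp_all only: x_def y_def z_def mult_cnj_radius)
  have d: "z \<noteq> x" "z \<noteq> y"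
    using assms(4,5) by (auto simp: x_def y_def z_def)
  have "r \<noteq> 0"
    using assms by auto
  then have nz: "x \<noteq> 0" "y \<noteq> 0" "z \<noteq> 0"
    using n by auto
  have c: "cnj x = of_real (r\<^sup>2) / x" "cnj y = of_real (r\<^sup>2) / y" "cnj z = of_real (r\<^sup>2) / z"
    using n nz by (metis nonzero_mult_div_cancel_left)+
  have "cnj ((x - z) / (y - z)) = (x - z) / (y - z) * (y / x)"
    unfolding complex_cnj_divide complex_cnj_diff c
    using nz d \<open>r \<noteq> 0\<close> by (simp add: divide_simps) (simp add: algebra_simps)
  then show ?thesis
    by (simp add: x_def y_def z_def)
qed

lemma noncollinear_distinct:
  assumes "\<not> collinear {X, Y, Z}"
  shows "X \<noteq> Y" "Y \<noteq> Z" "Z \<noteq> X"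
  using assms by (auto simp: insert_commute)

text \<open>By \<open>inscribed_angle\<close>, the quotient \<open>(Y - Q) / (X - Q)\<close> depends only on the triangle, and
it determines \<open>Q\<close>.\<close>

lemma circumcenter_unique:
  fixes X Y Z :: complex
  assumes "X \<noteq> Y" "Y \<noteq> Z" "Z \<noteq> X"
    and "dist Q X = dist Q Y" "dist Q Y = dist Q Z" "dist Q' X = dist Q' Y" "dist Q' Y = dist Q' Z"
  shows "Q = Q'"
proof -
  have nz: "X - Q \<noteq> 0" "X - Q' \<noteq> 0" "Y - Q \<noteq> 0" "Y - Q' \<noteq> 0"
    using assms by auto
  have "cnj ((X - Z) / (Y - Z)) = (X - Z) / (Y - Z) * ((Y - Q) / (X - Q))"
    "cnj ((X - Z) / (Y - Z)) = (X - Z) / (Y - Z) * ((Y - Q') / (X - Q'))"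
    using assms by (metis inscribed_angle)+
  then have "(X - Z) / (Y - Z) * ((Y - Q) / (X - Q)) = (X - Z) / (Y - Z) * ((Y - Q') / (X - Q'))"
    by (rule trans[OF sym])
  moreover have "(X - Z) / (Y - Z) \<noteq> 0"
    using assms by simp
  ultimately have "(Y - Q) / (X - Q) = (Y - Q') / (X - Q')"
    by (metis mult_left_cancel)
  then have "(Y - X) * (Q - Q') = 0"
    using nz by (simp add: field_simps)
  then show ?thesis
    using assms(1) by simp
qed

lemma circumcenter_exists:
  fixes X Y Z :: complex
  assumes "\<not> collinear {X, Z, Y}"
  shows "\<exists>Q. dist Q X = dist Q Y \<and> dist Q Y = dist Q Z"
proof -
  define w where "w = (X - Z) / (Y - Z)"
  have "Y \<noteq> Z"
    using assms by auto
  have "cnj w - w \<noteq> 0"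
    using assms unfolding collinear_iff_quotient_real[of Y Z X, folded w_def]
    by (metis collinear_iff_quotient_real insert_commute Reals_cnj_iff eq_iff_diff_eq_0 w_def)
  define y where "y = Y - Z"
  \<comment> \<open>The solution of \<open>(X - Q) / (Y - Q) = w / cnj w\<close>, as the inscribed angle theorem demands.\<close>
  define Q where "Q = Z + y * (w * (cnj w - 1) / (cnj w - w))"
  have Y: "Y = Z + y" and X: "X = Z + y * w"
    using \<open>Y \<noteq> Z\<close> by (simp_all add: y_def w_def)
  have n: "norm (cnj w - 1) = norm (1 - w)"
    by (metis complex_cnj_diff complex_cnj_one complex_mod_cnj norm_minus_commute)
  have "Q - Z = y * w * (cnj w - 1) / (cnj w - w)"
    "Q - Y = - (y * cnj w * (1 - w) / (cnj w - w))"
    "Q - X = - (y * w * (1 - w) / (cnj w - w))"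
    using \<open>cnj w - w \<noteq> 0\<close> by (simp_all add: Q_def X Y divide_simps) (simp_all add: algebra_simps)
  then have "dist Q X = dist Q Y \<and> dist Q Y = dist Q Z"
    unfolding dist_norm by (simp add: norm_divide norm_mult n)
  then show ?thesis ..
qed

lemma circumcenter_dist:
  assumes "\<not> collinear {X, Y, Z}"
  shows "dist (circumcenter X Y Z) X = dist (circumcenter X Y Z) Y"
    and "dist (circumcenter X Y Z) Y = dist (circumcenter X Y Z) Z"
proof -
  have "\<exists>!Q. dist Q X = dist Q Y \<and> dist Q Y = dist Q Z"
    using circumcenter_exists[of X Z Y] circumcenter_unique[of X Y Z] noncollinear_distinct[OF assms] assms
    by (metis insert_commute)
  then have "dist (circumcenter X Y Z) X = dist (circumcenter X Y Z) Y \<and>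
      dist (circumcenter X Y Z) Y = dist (circumcenter X Y Z) Z"
    unfolding circumcenter_def by (rule theI')
  then show "dist (circumcenter X Y Z) X = dist (circumcenter X Y Z) Y"
    and "dist (circumcenter X Y Z) Y = dist (circumcenter X Y Z) Z" by auto
qed

text \<open>The central angle over \<open>X Y\<close> is the sum of the two inscribed angles, as they are equal modulo
\<open>\<pi>\<close>.\<close>

lemma circumcenter_angle_sum:
  assumes "dist Q X = r" "dist Q Y = r" "dist Q Z = r" "dist Q T = r"
    and "Z \<noteq> X" "Z \<noteq> Y" "T \<noteq> X" "T \<noteq> Y"
  shows "angle_sum Q X Y Z T"
proof -
  define w v where "w = (X - Z) / (Y - Z)" and "v = (X - T) / (Y - T)"
  define x y where "x = X - Q" and "y = Y - Q"
  have xy: "x \<noteq> 0" "y \<noteq> 0"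
    using assms by (auto simp: x_def y_def)
  have h: "cnj w = w * (y / x)" and k: "cnj v = v * (y / x)"
    using inscribed_angle[OF assms(1-3)] inscribed_angle[OF assms(1,2,4)] assms
    by (simp_all add: w_def v_def x_def y_def)
  have "cnj (y / x) = x / y"
  proof -
    have "y * cnj y = of_real (r\<^sup>2)" "x * cnj x = of_real (r\<^sup>2)"
      using assms(1,2) by (simp_all only: x_def y_def mult_cnj_radius)
    then show ?thesis
      using xy by (simp add: field_simps)
  qed
  then have "cnj (w * v * (y / x)) = w * (y / x) * (v * (y / x)) * (x / y)"
    unfolding complex_cnj_mult h k by simp
  then have "cnj (w * v * (y / x)) = w * v * (y / x)"
    using xy by simp
  moreover have "isogonal_dir Z X T Q / isogonal_dir Z Y T Q = w * v * (y / x)"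
    using assms xy by (simp add: isogonal_dir_def w_def v_def x_def y_def divide_simps)
      (simp add: algebra_simps)
  ultimately show ?thesis
    by (simp add: angle_sum_def Reals_cnj_iff)
qed

text \<open>Four points on a circle or on a line have a real cross ratio; on the circle both \<open>S\<close> and
\<open>Q\<close> see the chord \<open>X Y\<close> under half the same central angle.\<close>

lemma circle_through_cross_ratio:
  assumes "S \<in> circle_through X Q Y" "X \<noteq> Y" "Q \<noteq> X" "Q \<noteq> Y"
  shows "(X - S) * (Y - Q) / ((Y - S) * (X - Q)) \<in> \<real>"
proof (cases "S = X \<or> S = Y")
  case True
  then show ?thesis by auto
next
  case False
  have "(X - S) / (Y - S) / ((X - Q) / (Y - Q)) \<in> \<real>"
  proof (cases "collinear {X, Q, Y}")
    case True
    then have Y: "Y \<in> affine hull {X, Q}"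
      using assms by (simp add: collinear_3_affine_hull)
    then have "affine hull {X, Q, Y} = affine hull {X, Q}"
      using hull_redundant[OF Y] by (simp add: insert_commute)
    then have S: "S \<in> affine hull {X, Q}"
      using assms(1) True by (simp add: circle_through_def)
    have *: "\<exists>t. P - R = t *\<^sub>R (Q - X)" if "P \<in> affine hull {X, Q}" "R \<in> affine hull {X, Q}" for P R
      using line_along_diff[of P X "Q - X" R] that by (metis line_def line_eq_line_along)
    have "X \<in> affine hull {X, Q}" "Q \<in> affine hull {X, Q}"
      by (simp_all add: hull_inc)
    then obtain a b c d where "X - S = a *\<^sub>R (Q - X)" "Y - S = b *\<^sub>R (Q - X)"
      "X - Q = c *\<^sub>R (Q - X)" "Y - Q = d *\<^sub>R (Q - X)"
      using * S Y by meson
    then show ?thesis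
      using assms by (simp add: scaleR_conv_of_real)
  next
    case nc: False
    define K where "K = circumcenter X Q Y"
    have K: "dist K X = dist K Q" "dist K Q = dist K Y"
      using circumcenter_dist[OF nc] by (simp_all add: K_def)
    have S: "dist K S = dist K X"
      using assms(1) nc by (simp add: circle_through_def circumcircle_def K_def)
    have c: "cnj ((X - S) / (Y - S)) = (X - S) / (Y - S) * ((Y - K) / (X - K))"
      "cnj ((X - Q) / (Y - Q)) = (X - Q) / (Y - Q) * ((Y - K) / (X - K))"
      by (rule inscribed_angle[where r = "dist K X"]; use K S False assms in simp)+
    have "Y \<noteq> K" "X \<noteq> K"
      using K assms by auto
    then have "cnj ((X - S) / (Y - S) / ((X - Q) / (Y - Q))) = (X - S) / (Y - S) / ((X - Q) / (Y - Q))"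
      unfolding complex_cnj_divide[of "(X - S) / (Y - S)"] c by simp
    then show ?thesis
      by (simp add: Reals_cnj_iff)
  qed
  then show ?thesis by simp
qed

lemma circle_through_circumcenter_angle_sum:
  assumes "dist Q X = r" "dist Q Y = r" "dist Q Z = r" "dist Q T = r"
    and "Z \<noteq> X" "Z \<noteq> Y" "T \<noteq> X" "T \<noteq> Y" "X \<noteq> Y"
    and "S \<in> circle_through X Q Y"
  shows "angle_sum S X Y Z T"
proof -
  have Q: "Q \<noteq> X" "Q \<noteq> Y"
    using assms by auto
  have "angle_sum Q X Y Z T"
    using circumcenter_angle_sum assms by blast
  moreover have "inverse ((X - S) * (Y - Q) / ((Y - S) * (X - Q))) \<in> \<real>"
    using circle_through_cross_ratio[of S X Q Y] assms Q by (metis Reals_inverse)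
  moreover have "isogonal_dir Z X T S / isogonal_dir Z Y T S =
      isogonal_dir Z X T Q / isogonal_dir Z Y T Q * inverse ((X - S) * (Y - Q) / ((Y - S) * (X - Q)))"
    using Q by (simp add: isogonal_dir_def divide_simps) (simp add: algebra_simps)
  ultimately show ?thesis
    by (metis Reals_mult angle_sum_def)
qed

text \<open>Otherwise the central angle and the inscribed angle over the chord \<open>X Y\<close>, one being twice the other,
would agree modulo \<open>\<pi>\<close>, and \<open>X\<close>, \<open>Y\<close>, \<open>Z\<close> would be
collinear.\<close>

lemma concyclic_not_on_circle_through_circumcenter:
  assumes "dist Q X = r" "dist Q Y = r" "dist Q Z = r" "\<not> collinear {X, Z, Y}"
  shows "Z \<notin> circle_through X Q Y"
proof
  assume "Z \<in> circle_through X Q Y"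
  have d: "Z \<noteq> X" "Z \<noteq> Y" "X \<noteq> Y"
    using noncollinear_distinct[OF assms(4)] by auto
  have Q: "Q \<noteq> X" "Q \<noteq> Y"
    using assms d by auto
  have "(X - Z) * (Y - Q) / ((Y - Z) * (X - Q)) = cnj ((X - Z) / (Y - Z))"
    using inscribed_angle[OF assms(1-3)] d by simp
  then have "cnj ((X - Z) / (Y - Z)) \<in> \<real>"
    using circle_through_cross_ratio[of Z X Q Y] \<open>Z \<in> circle_through X Q Y\<close> d Q by simp
  then have "(X - Z) / (Y - Z) \<in> \<real>"
    by (simp add: Reals_cnj_iff del: complex_cnj_divide)
  with assms(4) show False
    by (metis collinear_iff_quotient_real insert_commute)
qed

section \<open>Circles of similitude of two circles with a common chord\<close>

text \<open>On the right, the circle enters only through \<open>R\<close> and the unimodular number \<open>(Y - Q) / (X -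
Q)\<close>, the rotation by the central angle over \<open>X Y\<close>. Hence power over squared radius can be
compared for two circles through \<open>X\<close> and \<open>Y\<close> by comparing these rotations.\<close>

lemma power_of_point_over_chord:
  assumes "dist Q X = R" "dist Q Y = R" "R \<noteq> 0"
  shows "((dist P Q)\<^sup>2 - R\<^sup>2) * (dist X Y)\<^sup>2 =
    2 * R\<^sup>2 * Re ((X - P) * cnj (Y - P) * (1 - (Y - Q) / (X - Q)))"
proof -
  define x y p where "x = X - Q" and "y = Y - Q" and "p = P - Q"
  have n: "x * cnj x = of_real (R\<^sup>2)" "y * cnj y = of_real (R\<^sup>2)" "(norm x)\<^sup>2 = R\<^sup>2" "(norm y)\<^sup>2 = R\<^sup>2"
    using assms(1,2) mult_cnj_radius[OF assms(1)] mult_cnj_radius[OF assms(2)]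
    by (simp_all add: x_def y_def dist_norm norm_minus_commute)
  have "x \<noteq> 0"
    using n(3) assms(3) by auto
  have h: "of_real (R\<^sup>2) * (1 - y / x) = of_real (R\<^sup>2) - y * cnj x"
    using \<open>x \<noteq> 0\<close> unfolding n(1)[symmetric] by (simp add: field_simps)
  have lin: "r * Re (e * f) = Re (e * (of_real r * f))" "Re (of_real r * f) = r * Re f" for r e f
    by (simp_all add: algebra_simps)
  have "R\<^sup>2 * Re ((x - p) * cnj (y - p) * (1 - y / x)) =
      Re ((x - p) * cnj (y - p) * (of_real (R\<^sup>2) * (1 - y / x)))"
    by (rule lin(1))
  also have "\<dots> = Re ((x - p) * cnj (y - p) * (of_real (R\<^sup>2) - y * cnj x))"
    by (simp only: h)
  finally have 1: "R\<^sup>2 * Re ((x - p) * cnj (y - p) * (1 - y / x)) =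
      Re ((x - p) * cnj (y - p) * (of_real (R\<^sup>2) - y * cnj x))" .
  define c where "c = Re (x * cnj y)"
  have "(x - p) * cnj (y - p) * (of_real (R\<^sup>2) - y * cnj x) =
      of_real (R\<^sup>2) * (x * cnj y) - (x * cnj x) * (y * cnj y)
      + ((y * cnj y) * p * cnj x - of_real (R\<^sup>2) * p * cnj y)
      - (of_real (R\<^sup>2) * x * cnj p - (x * cnj x) * y * cnj p)
      + (p * cnj p) * (of_real (R\<^sup>2) - y * cnj x)"
    by (simp add: algebra_simps)
  also have "\<dots> = of_real (R\<^sup>2) * (x * cnj y - of_real (R\<^sup>2))
      + of_real (R\<^sup>2) * (p * cnj (x - y) - cnj (p * cnj (x - y)))
      + of_real ((norm p)\<^sup>2) * (of_real (R\<^sup>2) - cnj (x * cnj y))"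
    unfolding n(1,2) complex_norm_square[of p] by (simp add: algebra_simps)
  finally have "(x - p) * cnj (y - p) * (of_real (R\<^sup>2) - y * cnj x) = \<dots>" .
  then have 2: "Re ((x - p) * cnj (y - p) * (of_real (R\<^sup>2) - y * cnj x)) =
      R\<^sup>2 * (c - R\<^sup>2) + (norm p)\<^sup>2 * (R\<^sup>2 - c)"
    by (simp only: plus_complex.sel minus_complex.sel Re_complex_of_real cnj.sel
        lin(2) c_def) simp
  have 3: "(norm (x - y))\<^sup>2 = 2 * (R\<^sup>2 - c)"
    using n(3,4) unfolding c_def cmod_power2 by (simp add: power2_eq_square algebra_simps)
  have "((norm p)\<^sup>2 - R\<^sup>2) * (norm (x - y))\<^sup>2 =
      2 * Re ((x - p) * cnj (y - p) * (of_real (R\<^sup>2) - y * cnj x))"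
    unfolding 2 3 by (simp add: algebra_simps)
  with 1 show ?thesis
    by (simp add: x_def y_def p_def dist_norm)
qed

text \<open>A nonzero real linear form on the plane takes equal values at two distinct points of the unit circle precisely when
they are mirror images in its axis.\<close>

lemma Re_mult_unit_eq_iff:
  fixes z h k :: complex
  assumes "norm h = 1" "norm k = 1" "h \<noteq> k"
  shows "Re (z * h) = Re (z * k) \<longleftrightarrow> z * h * k = cnj z"
proof -
  have u: "h * cnj h = 1" "k * cnj k = 1" "h \<noteq> 0" "k \<noteq> 0"
    using assms(1,2) by (auto simp: complex_norm_square[symmetric])
  then have c: "cnj h = 1 / h" "cnj k = 1 / k"
    by (metis nonzero_mult_div_cancel_left)+
  have Re0: "Re w = 0 \<longleftrightarrow> w + cnj w = 0" for w
    by (simp add: complex_eq_iff)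
  have "Re (z * h) = Re (z * k) \<longleftrightarrow> Re (z * (h - k)) = 0"
    by (simp add: algebra_simps)
  also have "\<dots> \<longleftrightarrow> z * (h - k) + cnj (z * (h - k)) = 0"
    by (rule Re0)
  also have "z * (h - k) + cnj (z * (h - k)) = (h - k) * (z * h * k - cnj z) / (h * k)"
    using u(3,4) by (simp add: c divide_simps) (simp add: algebra_simps)
  also have "\<dots> = 0 \<longleftrightarrow> z * h * k = cnj z"
    using u(3,4) assms(3) by simp
  finally show ?thesis .
qed

text \<open>The definition of \<open>CS\<close> divides by \<open>dist P Q'\<close>. At \<open>P = Q'\<close> that quotient is
zero, whereas the positive ratio \<open>R / R'\<close> is not; this agrees with the right-hand side because the
centers differ.\<close>

lemma CS_iff:
  assumes "Q \<noteq> Q'" "R > 0" "R' > 0"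
  shows "P \<in> CS (Q, R) (Q', R') \<longleftrightarrow> dist P Q / R = dist P Q' / R'"
proof (cases "P = Q'")
  case True
  then show ?thesis
    using assms by (auto simp: CS_def)
next
  case False
  then show ?thesis
    using assms by (auto simp: CS_def field_simps)
qed

text \<open>Lying on the circle of similitude means equal ratios of power to squared radius. By
\<open>power_of_point_over_chord\<close> and \<open>Re_mult_unit_eq_iff\<close> this fixes twice the angle
\<open>\<angle>XPY\<close> as the sum of the two central angles, that is, \<open>\<angle>XPY\<close> modulo
\<open>\<pi>\<close> as the sum of the two inscribed angles.\<close>

lemma CS_iff_angle_sum:
  assumes d1: "dist Q X = R" "dist Q Y = R" "dist Q Z = R" "R > 0"
    and d2: "dist Q' X = R'" "dist Q' Y = R'" "dist Q' T = R'" "R' > 0"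
    and "Q \<noteq> Q'" "X \<noteq> Y" "Z \<noteq> X" "Z \<noteq> Y" "T \<noteq> X" "T \<noteq> Y" "P \<noteq> X" "P \<noteq> Y"
  shows "P \<in> CS (Q, R) (Q', R') \<longleftrightarrow> angle_sum P X Y Z T"
proof -
  define z where "z = (X - P) * cnj (Y - P)"
  define h k where "h = (Y - Q) / (X - Q)" and "k = (Y - Q') / (X - Q')"
  have nz: "X \<noteq> Q" "X \<noteq> Q'" "Y \<noteq> Q" "Y \<noteq> Q'"
    using d1 d2 by auto
  have "norm h = 1" "norm k = 1"
    using d1 d2 by (auto simp: h_def k_def norm_divide dist_norm norm_minus_commute)
  moreover have "h \<noteq> k"
  proof
    assume "h = k"
    then have "(Y - X) * (Q - Q') = 0"
      using nz by (simp add: h_def k_def field_simps)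
    then show False
      using assms by simp
  qed
  moreover have "dist P Q / R = dist P Q' / R' \<longleftrightarrow> Re (z * h) = Re (z * k)"
  proof -
    have *: "(dist P Q / R)\<^sup>2 = 1 + 2 * Re (z * (1 - (Y - Q) / (X - Q))) / (dist X Y)\<^sup>2"
      if "dist Q X = R" "dist Q Y = R" "R > 0" for Q R
      using power_of_point_over_chord[of Q X R Y P] that \<open>X \<noteq> Y\<close>
      by (simp add: z_def field_simps)
    have "dist P Q / R = dist P Q' / R' \<longleftrightarrow> (dist P Q / R)\<^sup>2 = (dist P Q' / R')\<^sup>2"
      using d1(4) d2(4) by (metis divide_nonneg_pos power2_eq_iff_nonneg zero_le_dist)
    also have "\<dots> \<longleftrightarrow> Re (z * (1 - h)) = Re (z * (1 - k))"
    proof -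
      have "1 + 2 * a / (dist X Y)\<^sup>2 = 1 + 2 * b / (dist X Y)\<^sup>2 \<longleftrightarrow> a = b" for a b
        using \<open>X \<noteq> Y\<close> by simp
      then show ?thesis
        unfolding *[OF d1(1,2,4)] *[OF d2(1,2,4)] h_def k_def .
    qed
    also have "\<dots> \<longleftrightarrow> Re (z * h) = Re (z * k)"
      unfolding right_diff_distrib minus_complex.sel by linarith
    finally show ?thesis .
  qed
  ultimately have "P \<in> CS (Q, R) (Q', R') \<longleftrightarrow> z * h * k = cnj z"
    using CS_iff[of Q Q' R R' P] Re_mult_unit_eq_iff[of h k z] assms by simp
  also have "\<dots> \<longleftrightarrow> angle_sum P X Y Z T"
  proof -
    define w v where "w = (X - Z) / (Y - Z)" and "v = (X - T) / (Y - T)"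
    have wv: "w \<noteq> 0" "v \<noteq> 0"
      using assms by (auto simp: w_def v_def)
    have h: "cnj w = w * h" and k: "cnj v = v * k"
      using inscribed_angle[OF d1(1-3)] inscribed_angle[OF d2(1-3)] assms
      by (simp_all add: w_def v_def h_def k_def)
    define x y where "x = X - P" and "y = Y - P"
    have xy: "x \<noteq> 0" "y \<noteq> 0"
      using assms by (auto simp: x_def y_def)
    have "isogonal_dir Z X T P / isogonal_dir Z Y T P = w * v * (y / x)"
      using assms by (simp add: isogonal_dir_def w_def v_def x_def y_def divide_simps)
       (simp add: algebra_simps)
    moreover have "w * v * (y / x) \<in> \<real> \<longleftrightarrow> w * h * (v * k) * (cnj y / cnj x) = w * v * (y / x)"
      by (simp add: Reals_cnj_iff flip: h k)
    moreover have "\<dots> \<longleftrightarrow> z * h * k = cnj z"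
      using xy wv by (simp add: z_def x_def[symmetric] y_def[symmetric] divide_simps)
        (simp add: mult_ac)
    ultimately show ?thesis
      by (simp add: angle_sum_def)
  qed
  finally show ?thesis .
qed

section \<open>Isogonal conjugates in a nondegenerate quadrilateral\<close>

context
  fixes A B C D :: complex
  assumes nondegenerate: "nondegenerate_quadrilateral A B C D"
begin

lemma noncollinear:
  "\<not> collinear {D, A, B}" "\<not> collinear {A, B, C}" "\<not> collinear {B, C, D}" "\<not> collinear {C, D, A}"
  using nondegenerate by (auto simp: nondegenerate_quadrilateral_def)

lemma distinct_vertices: "A \<noteq> B" "A \<noteq> C" "A \<noteq> D" "B \<noteq> C" "B \<noteq> D" "C \<noteq> D"
  using noncollinear noncollinear_distinct by metis+

lemma diagonals_not_parallel: "(B - D) / (A - C) \<notin> \<real>"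
proof -
  have "(C - A) / (D - B) \<notin> \<real>"
    using nondegenerate distinct_vertices
    by (auto simp: nondegenerate_quadrilateral_def line_eq_line_along parallel_line_along)
  moreover have "(C - A) / (D - B) = inverse ((B - D) / (A - C))"
    by (metis inverse_divide minus_diff_eq minus_divide_divide)
  ultimately show ?thesis
    by (metis Reals_inverse)
qed

lemma isogonal_lines:
  assumes "P \<notin> {A, B, C, D}"
  shows "isogonal_line D A B P = line_along A (isogonal_dir D A B P)"
    "isogonal_line A B C P = line_along B (isogonal_dir A B C P)"
    "isogonal_line B C D P = line_along C (isogonal_dir B C D P)"
    "isogonal_line C D A P = line_along D (isogonal_dir C D A P)"
  using assms noncollinear by (auto intro!: isogonal_line_eq)

lemma isogonal_dirs_nonzero:
  assumes "P \<notin> {A, B, C, D}"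
  shows "isogonal_dir D A B P \<noteq> 0" "isogonal_dir A B C P \<noteq> 0"
    "isogonal_dir B C D P \<noteq> 0" "isogonal_dir C D A P \<noteq> 0"
  using assms distinct_vertices by (auto simp: isogonal_dir_def)

text \<open>The angle sums over the diagonals make opposite isogonal lines parallel. The one over \<open>A B\<close> makes the
quotient of the isogonal directions at \<open>A\<close> and \<open>B\<close> a real multiple of \<open>(B - D) / (A
- C)\<close>, so adjacent lines are not parallel.\<close>

lemma Iso_parallelogram_if_angle_sums:
  assumes P: "P \<notin> {A, B, C, D}"
    and AC: "angle_sum P A C B D" and BD: "angle_sum P B D C A" and AB: "angle_sum P A B C D"
  shows "Iso_is_parallelogram A B C D P"
proof -
  have "isogonal_dir D A B P / isogonal_dir B C D P \<in> \<real>"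
    using AC by (simp add: angle_sum_def isogonal_dir_commute)
  moreover have "isogonal_dir A B C P / isogonal_dir C D A P \<in> \<real>"
    using BD by (simp add: angle_sum_def isogonal_dir_commute)
  moreover have "isogonal_dir D A B P / isogonal_dir A B C P \<notin> \<real>"
  proof
    assume "isogonal_dir D A B P / isogonal_dir A B C P \<in> \<real>"
    moreover have "(B - D) / (A - C) = - (isogonal_dir D A B P / isogonal_dir A B C P) /
        (isogonal_dir C A D P / isogonal_dir C B D P)"
      using P distinct_vertices by (simp add: isogonal_dir_def divide_simps) (simp add: algebra_simps)
    ultimately have "(B - D) / (A - C) \<in> \<real>"
      using AB by (simp only: angle_sum_def Reals_divide Reals_minus_iff)
    with diagonals_not_parallel show False ..
  qed
  ultimately show ?thesis
    unfolding Iso_is_parallelogram_def Iso_def Let_def isogonal_lines[OF P]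
    using parallel_line_pairs_meet isogonal_dirs_nonzero[OF P] by simp
qed

text \<open>The equation characterizes \<open>P\<close> as the center of the spiral similarity taking \<open>A\<close> to
\<open>B\<close> and \<open>D\<close> to \<open>C\<close>, the Miquel point of the four side lines. All four
isogonal lines have the direction \<open>A + C - B - D\<close>, that of the line through the midpoints of the two
diagonals.\<close>

lemma Iso_infinite_if_Miquel:
  assumes P: "P \<notin> {A, B, C, D}"
    and eq: "(A - P) * (C - P) = (B - P) * (D - P)"
  shows "\<exists>d. Iso A B C D P = (Infinite d, Infinite d, Infinite d, Infinite d)"
proof -
  define m where "m = A + C - B - D"
  have "(D - A) * (B - A) = - m * (P - A)" "(A - B) * (C - B) = m * (P - B)"
    "(B - C) * (D - C) = - m * (P - C)" "(C - D) * (A - D) = m * (P - D)"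
    using eq unfolding m_def by algebra+
  then have u: "isogonal_dir D A B P = - m" "isogonal_dir A B C P = m"
    "isogonal_dir B C D P = - m" "isogonal_dir C D A P = m"
    using P by (auto simp: isogonal_dir_def)
  have "m \<noteq> 0"
    using isogonal_dirs_nonzero(2)[OF P] u by simp
  then have par: "parallel (line_along V w) (line_along V' w')"
    if "w \<in> {m, -m}" "w' \<in> {m, -m}" for V V' w w'
    using that by (auto simp: parallel_line_along)
  then have "meet (line_along V w) (line_along V' w') = Infinite (direction (line_along A m))"
    if "w \<in> {m, -m}" "w' \<in> {m, -m}" for V V' w w'
    using meet_parallel[OF par[OF that]] par[OF that(1), of m V A] unfolding parallel_def by simp
  then show ?thesis
    unfolding Iso_def Let_def isogonal_lines[OF P] u by simp
qed

end

section \<open>Angle sums at the isoptic point and at the Simson point\<close>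

lemma cyclic_circumcenter:
  assumes "nondegenerate_quadrilateral A B C D" "cyclic_quadrilateral A B C D"
  obtains r where "r > 0" "dist (circumcenter A B C) A = r" "dist (circumcenter A B C) B = r"
    "dist (circumcenter A B C) C = r" "dist (circumcenter A B C) D = r"
proof -
  obtain Z r where Z: "dist Z A = r" "dist Z B = r" "dist Z C = r" "dist Z D = r"
    using assms(2) by (auto simp: cyclic_quadrilateral_def)
  then have "circumcenter A B C = Z"
    using circumcenter_unique[of A B C] circumcenter_dist[OF noncollinear(2)[OF assms(1)]] distinct_vertices[OF assms(1)]
    by metis
  moreover have "r > 0"
    using Z distinct_vertices[OF assms(1)] by (metis dist_eq_0_iff zero_less_dist_iff)
  ultimately show thesis
    using that Z by simp
qed

lemma isoptic_cyclic:
  assumes "nondegenerate_quadrilateral A B C D" "cyclic_quadrilateral A B C D"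
  defines "W \<equiv> circumcenter A B C"
  shows "W \<notin> {A, B, C, D}" "angle_sum W A C B D" "angle_sum W B D C A" "angle_sum W A B C D"
proof -
  obtain r where "r > 0" "dist W A = r" "dist W B = r" "dist W C = r" "dist W D = r"
    using cyclic_circumcenter[OF assms(1,2)] unfolding W_def .
  then show "W \<notin> {A, B, C, D}" "angle_sum W A C B D" "angle_sum W B D C A" "angle_sum W A B C D"
    using distinct_vertices[OF assms(1)] by (auto intro!: circumcenter_angle_sum)
qed

lemma cyclic_Simson_angle_sums:
  assumes "nondegenerate_quadrilateral A B C D" "cyclic_quadrilateral A B C D"
    and S: "S \<in> circle_through B (circumcenter A B C) D" "S \<in> circle_through A (circumcenter A B C) C"
  shows "S \<notin> {A, B, C, D}" "angle_sum S A C B D" "angle_sum S B D C A"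
proof -
  define Q where "Q = circumcenter A B C"
  obtain r where r: "dist Q A = r" "dist Q B = r" "dist Q C = r" "dist Q D = r"
    using cyclic_circumcenter[OF assms(1,2)] unfolding Q_def .
  note d = distinct_vertices[OF assms(1)] and nc = noncollinear[OF assms(1)]
  have "A \<notin> circle_through B Q D" "C \<notin> circle_through B Q D"
    "B \<notin> circle_through A Q C" "D \<notin> circle_through A Q C"
    by (rule concyclic_not_on_circle_through_circumcenter[of _ _ r];
        use r nc in \<open>simp add: insert_commute\<close>)+
  with S show "S \<notin> {A, B, C, D}"
    by (auto simp: Q_def)
  show "angle_sum S A C B D" "angle_sum S B D C A"
    using r d S by (auto intro!: circle_through_circumcenter_angle_sum[of Q _ r] simp: Q_def)
qed

text \<open>A second point \<open>S\<close> would lie on one circle or line with \<open>Q\<close>, \<open>A\<close>,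
\<open>B\<close> and on one with \<open>Q\<close>, \<open>B\<close>, \<open>D\<close>. Inversion in the
circumcircle, which is \<open>z \<mapsto> 1 / z\<close> about its center up to conjugation and scaling, turns these
into the lines \<open>A B\<close> and \<open>B D\<close>. It fixes their common point \<open>B\<close>, and the
image of \<open>S\<close> would be another one, so the two lines would coincide.\<close>

lemma cyclic_angle_sums_unique:
  assumes "nondegenerate_quadrilateral A B C D"
    and Q: "dist Q A = r" "dist Q B = r" "dist Q D = r" "Q \<notin> {A, B, D}"
      "angle_sum Q A B C D" "angle_sum Q B D C A"
    and S: "S \<notin> {A, B, D}" "angle_sum S A B C D" "angle_sum S B D C A"
  shows "S = Q"
proof (rule ccontr)
  assume "S \<noteq> Q"
  note d = distinct_vertices[OF assms(1)] and nc = noncollinear[OF assms(1)]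
  define a b d s where "a = A - Q" and "b = B - Q" and "d = D - Q" and "s = S - Q"
  have nz: "a \<noteq> 0" "b \<noteq> 0" "d \<noteq> 0" "s \<noteq> 0" "a \<noteq> b" "s \<noteq> a" "s \<noteq> b" "s \<noteq> d"
    using Q(4) S(1) \<open>S \<noteq> Q\<close> d by (auto simp: a_def b_def d_def s_def)
  have "(S - A) * (Q - B) / ((S - B) * (Q - A)) \<in> \<real>" "(S - B) * (Q - D) / ((S - D) * (Q - B)) \<in> \<real>"
    using Q S d by (auto intro!: cross_ratio_real_of_angle_sums)
  moreover have "S - A = s - a" "S - B = s - b" "S - D = s - d" "Q - A = - a" "Q - B = - b" "Q - D = - d"
    by (simp_all add: a_def b_def d_def s_def)
  ultimately have "(s - a) * b / ((s - b) * a) \<in> \<real>" "(s - b) * d / ((s - d) * b) \<in> \<real>"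
    by simp_all
  then have "(s - a) * b / ((s - b) * a) \<in> \<real>" "(s - d) * b / ((s - b) * d) \<in> \<real>"
    by (simp, metis Reals_inverse inverse_divide)
  then have "(1 - (s - d) * b / ((s - b) * d)) / (1 - (s - a) * b / ((s - b) * a)) \<in> \<real>"
    by (metis Reals_1 Reals_diff Reals_divide)
  \<comment> \<open>Each cross ratio is a quotient such as \<open>(1/s - 1/a) / (1/s - 1/b)\<close>, so \<open>1/s\<close> cancels here.\<close>
  also have "(1 - (s - d) * b / ((s - b) * d)) / (1 - (s - a) * b / ((s - b) * a)) =
      (1 / d - 1 / b) / (1 / a - 1 / b)"
    using nz by (simp add: divide_simps) (simp add: algebra_simps)
  also have "\<dots> = cnj ((D - B) / (A - B))"
  proof -
    have c: "a * cnj a = of_real (r\<^sup>2)" "b * cnj b = of_real (r\<^sup>2)" "d * cnj d = of_real (r\<^sup>2)"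
      using mult_cnj_radius Q(1-3) by (simp_all add: a_def b_def d_def del: complex_cnj_diff)
    have "r \<noteq> 0"
      using Q by auto
    then have i: "1 / a = cnj a / of_real (r\<^sup>2)" "1 / b = cnj b / of_real (r\<^sup>2)" "1 / d = cnj d / of_real (r\<^sup>2)"
      using c nz by (simp_all add: field_simps)
    have "(1 / d - 1 / b) / (1 / a - 1 / b) = cnj (d - b) / cnj (a - b)"
      unfolding i using \<open>r \<noteq> 0\<close> by (simp flip: diff_divide_distrib)
    then show ?thesis
      by (simp add: a_def b_def d_def)
  qed
  finally have "(D - B) / (A - B) \<in> \<real>"
    by (metis Reals_cnj_iff complex_cnj_cnj)
  with nc(1) show False
    by (metis collinear_iff_quotient_real insert_commute)
qed

lemma circumcircle_obtains:
  assumes "\<not> collinear {X, Y, Z}"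
  obtains Q R where "circumcircle X Y Z = (Q, R)" "R > 0" "dist Q X = R" "dist Q Y = R" "dist Q Z = R"
proof (rule that)
  show "circumcircle X Y Z = (circumcenter X Y Z, dist (circumcenter X Y Z) X)"
    by (simp add: circumcircle_def)
  show "dist (circumcenter X Y Z) X > 0"
    using circumcenter_dist[OF assms] noncollinear_distinct[OF assms]
    by (metis dist_eq_0_iff zero_less_dist_iff)
qed (use circumcenter_dist[OF assms] in simp_all)

text \<open>In the noncyclic case no triad circle passes through the remaining vertex. Since any two of these circles share two
vertices, their centers are distinct.\<close>

lemma triad_circles_obtains:
  assumes "nondegenerate_quadrilateral A B C D"
    and "\<not> cyclic_quadrilateral A B C D"
  obtains Q1 R1 Q2 R2 Q3 R3 Q4 R4 where
    "circumcircle D A B = (Q1, R1)" "R1 > 0" "dist Q1 D = R1" "dist Q1 A = R1" "dist Q1 B = R1"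
    "circumcircle A B C = (Q2, R2)" "R2 > 0" "dist Q2 A = R2" "dist Q2 B = R2" "dist Q2 C = R2"
    "circumcircle B C D = (Q3, R3)" "R3 > 0" "dist Q3 B = R3" "dist Q3 C = R3" "dist Q3 D = R3"
    "circumcircle C D A = (Q4, R4)" "R4 > 0" "dist Q4 C = R4" "dist Q4 D = R4" "dist Q4 A = R4"
    "dist Q1 C \<noteq> R1" "dist Q2 D \<noteq> R2" "dist Q3 A \<noteq> R3" "dist Q4 B \<noteq> R4"
    "Q1 \<noteq> Q2" "Q1 \<noteq> Q3" "Q1 \<noteq> Q4" "Q2 \<noteq> Q3" "Q2 \<noteq> Q4" "Q3 \<noteq> Q4"
proof -
  have nc: "\<not> (dist Z A = r \<and> dist Z B = r \<and> dist Z C = r \<and> dist Z D = r)" for Z r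
  proof
    assume "dist Z A = r \<and> dist Z B = r \<and> dist Z C = r \<and> dist Z D = r"
    then have "{A, B, C, D} \<subseteq> sphere Z r" by simp
    with assms(2) show False
      unfolding cyclic_quadrilateral_def by blast
  qed
  obtain Q1 R1 where 1: "circumcircle D A B = (Q1, R1)" "R1 > 0" "dist Q1 D = R1" "dist Q1 A = R1" "dist Q1 B = R1"
    using circumcircle_obtains[OF noncollinear(1)[OF assms(1)]] .
  obtain Q2 R2 where 2: "circumcircle A B C = (Q2, R2)" "R2 > 0" "dist Q2 A = R2" "dist Q2 B = R2" "dist Q2 C = R2"
    using circumcircle_obtains[OF noncollinear(2)[OF assms(1)]] .
  obtain Q3 R3 where 3: "circumcircle B C D = (Q3, R3)" "R3 > 0" "dist Q3 B = R3" "dist Q3 C = R3" "dist Q3 D = R3"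
    using circumcircle_obtains[OF noncollinear(3)[OF assms(1)]] .
  obtain Q4 R4 where 4: "circumcircle C D A = (Q4, R4)" "R4 > 0" "dist Q4 C = R4" "dist Q4 D = R4" "dist Q4 A = R4"
    using circumcircle_obtains[OF noncollinear(4)[OF assms(1)]] .
  have out: "dist Q1 C \<noteq> R1" "dist Q2 D \<noteq> R2" "dist Q3 A \<noteq> R3" "dist Q4 B \<noteq> R4"
    using 1 2 3 4 nc by blast+
  have ne: "Q1 \<noteq> Q2" "Q1 \<noteq> Q3" "Q1 \<noteq> Q4" "Q2 \<noteq> Q3" "Q2 \<noteq> Q4" "Q3 \<noteq> Q4"
    using 1(3-5) 2(3-5) 3(3-5) 4(3-5) out by metis+
  show thesis
    by (rule that[OF 1 2 3 4 out ne])
qed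

text \<open>Opposite triad circles share a diagonal as chord. A vertex is excluded because it lies on exactly one circle of one
of the two opposite pairs.\<close>

lemma opposite_CS_angle_sums:
  assumes "nondegenerate_quadrilateral A B C D" "\<not> cyclic_quadrilateral A B C D"
    and "P \<in> CS (circumcircle D A B) (circumcircle B C D)"
    and "P \<in> CS (circumcircle A B C) (circumcircle C D A)"
  shows "P \<notin> {A, B, C, D}" "angle_sum P A C B D" "angle_sum P B D C A"
proof -
  obtain Q1 R1 Q2 R2 Q3 R3 Q4 R4 where c:
    "circumcircle D A B = (Q1, R1)" "R1 > 0" "dist Q1 D = R1" "dist Q1 A = R1" "dist Q1 B = R1"
    "circumcircle A B C = (Q2, R2)" "R2 > 0" "dist Q2 A = R2" "dist Q2 B = R2" "dist Q2 C = R2"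
    "circumcircle B C D = (Q3, R3)" "R3 > 0" "dist Q3 B = R3" "dist Q3 C = R3" "dist Q3 D = R3"
    "circumcircle C D A = (Q4, R4)" "R4 > 0" "dist Q4 C = R4" "dist Q4 D = R4" "dist Q4 A = R4"
    "dist Q1 C \<noteq> R1" "dist Q2 D \<noteq> R2" "dist Q3 A \<noteq> R3" "dist Q4 B \<noteq> R4"
    "Q1 \<noteq> Q2" "Q1 \<noteq> Q3" "Q1 \<noteq> Q4" "Q2 \<noteq> Q3" "Q2 \<noteq> Q4" "Q3 \<noteq> Q4"
    using triad_circles_obtains[OF assms(1,2)] .
  note d = distinct_vertices[OF assms(1)]
  have e: "dist P Q1 / R1 = dist P Q3 / R3" "dist P Q2 / R2 = dist P Q4 / R4"
    using assms(3,4) c by (simp_all add: CS_iff)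
  show P: "P \<notin> {A, B, C, D}"
    using e c by (auto simp: dist_commute)
  show "angle_sum P A C B D"
    using CS_iff_angle_sum[of Q2 A R2 C B Q4 R4 D P] c d P assms(4) by auto
  have "angle_sum P B D A C"
    using CS_iff_angle_sum[of Q1 B R1 D A Q3 R3 C P] c d P assms(3) by auto
  then show "angle_sum P B D C A"
    by (simp add: angle_sum_commute)
qed

text \<open>The isoptic point has equal ratios \<open>dist P Q / R\<close> for all four circles. Of the six equations three
suffice: the two for opposite circles and one that links the pairs, here the circles sharing the chord \<open>A
B\<close>.\<close>

lemma isoptic_point_noncyclic_iff:
  assumes "nondegenerate_quadrilateral A B C D" "\<not> cyclic_quadrilateral A B C D"
  shows "isoptic_point A B C D P \<longleftrightarrow>
    P \<in> CS (circumcircle D A B) (circumcircle B C D) \<and>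
    P \<in> CS (circumcircle A B C) (circumcircle C D A) \<and> angle_sum P A B C D"
proof -
  obtain Q1 R1 Q2 R2 Q3 R3 Q4 R4 where c:
    "circumcircle D A B = (Q1, R1)" "R1 > 0" "dist Q1 D = R1" "dist Q1 A = R1" "dist Q1 B = R1"
    "circumcircle A B C = (Q2, R2)" "R2 > 0" "dist Q2 A = R2" "dist Q2 B = R2" "dist Q2 C = R2"
    "circumcircle B C D = (Q3, R3)" "R3 > 0" "dist Q3 B = R3" "dist Q3 C = R3" "dist Q3 D = R3"
    "circumcircle C D A = (Q4, R4)" "R4 > 0" "dist Q4 C = R4" "dist Q4 D = R4" "dist Q4 A = R4"
    "dist Q1 C \<noteq> R1" "dist Q2 D \<noteq> R2" "dist Q3 A \<noteq> R3" "dist Q4 B \<noteq> R4"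
    "Q1 \<noteq> Q2" "Q1 \<noteq> Q3" "Q1 \<noteq> Q4" "Q2 \<noteq> Q3" "Q2 \<noteq> Q4" "Q3 \<noteq> Q4"
    using triad_circles_obtains[OF assms] .
  note d = distinct_vertices[OF assms(1)]
  have CS: "P \<in> CS (Q, R) (Q', R') \<longleftrightarrow> dist P Q / R = dist P Q' / R'"
    if "(Q, R) \<noteq> (Q', R')" "(Q, R) \<in> {(Q1, R1), (Q2, R2), (Q3, R3), (Q4, R4)}"
      "(Q', R') \<in> {(Q1, R1), (Q2, R2), (Q3, R3), (Q4, R4)}" for Q R Q' R'
    using that c by (intro CS_iff) auto
  have "isoptic_point A B C D P \<longleftrightarrow>
      dist P Q1 / R1 = dist P Q3 / R3 \<and> dist P Q2 / R2 = dist P Q4 / R4 \<and>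
      dist P Q1 / R1 = dist P Q2 / R2"
    unfolding isoptic_point_def triad_circles_def using assms(2) c CS by auto
  moreover have "P \<in> CS (Q1, R1) (Q2, R2) \<longleftrightarrow> angle_sum P A B C D"
    if "P \<in> CS (Q1, R1) (Q3, R3)" "P \<in> CS (Q2, R2) (Q4, R4)"
  proof -
    have "P \<notin> {A, B, C, D}"
      using opposite_CS_angle_sums(1)[OF assms] that c by simp
    then have "P \<in> CS (Q1, R1) (Q2, R2) \<longleftrightarrow> angle_sum P A B D C"
      using c d by (intro CS_iff_angle_sum) auto
    then show ?thesis
      by (simp add: angle_sum_commute)
  qed
  ultimately show ?thesis
    using c CS by auto
qed

lemma isoptic_point_angle_sums:
  assumes "nondegenerate_quadrilateral A B C D" "isoptic_point A B C D W"
  shows "W \<notin> {A, B, C, D}" "angle_sum W A C B D" "angle_sum W B D C A" "angle_sum W A B C D"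
proof -
  have "W \<notin> {A, B, C, D} \<and> angle_sum W A C B D \<and> angle_sum W B D C A \<and> angle_sum W A B C D"
  proof (cases "cyclic_quadrilateral A B C D")
    case True
    with assms(2) have "W = circumcenter A B C"
      by (simp add: isoptic_point_def)
    then show ?thesis
      using isoptic_cyclic[OF assms(1) True] by simp
  next
    case False
    then show ?thesis
      using isoptic_point_noncyclic_iff[OF assms(1) False] assms(2)
        opposite_CS_angle_sums[OF assms(1) False] by blast
  qed
  then show "W \<notin> {A, B, C, D}" "angle_sum W A C B D" "angle_sum W B D C A" "angle_sum W A B C D"
    by auto
qed

text \<open>The angle sum over \<open>A B\<close> must fail because together with the other two it characterizes the isoptic
point, from which the Simson point differs.\<close>

lemma Simson_point_angle_sums:
  assumes "nondegenerate_quadrilateral A B C D" "Simson_point A B C D S"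
  shows "S \<notin> {A, B, C, D}" "angle_sum S A C B D" "angle_sum S B D C A" "\<not> angle_sum S A B C D"
proof -
  have "S \<notin> {A, B, C, D} \<and> angle_sum S A C B D \<and> angle_sum S B D C A \<and> \<not> angle_sum S A B C D"
  proof (cases "cyclic_quadrilateral A B C D")
    case True
    define Q where "Q = circumcenter A B C"
    obtain r where r: "dist Q A = r" "dist Q B = r" "dist Q D = r"
      using cyclic_circumcenter[OF assms(1) True] unfolding Q_def .
    have S: "S \<notin> {A, B, C, D}" "angle_sum S A C B D" "angle_sum S B D C A" and "S \<noteq> Q"
      using cyclic_Simson_angle_sums[OF assms(1) True] assms(2) True
      by (auto simp: Simson_point_def isoptic_point_def Q_def)
    moreover have "\<not> angle_sum S A B C D"
      using cyclic_angle_sums_unique[OF assms(1) r] isoptic_cyclic[OF assms(1) True] S \<open>S \<noteq> Q\<close>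
      by (auto simp: Q_def)
    ultimately show ?thesis by blast
  next
    case False
    then show ?thesis
      using isoptic_point_noncyclic_iff[OF assms(1) False] assms(2)
        opposite_CS_angle_sums[OF assms(1) False] by (auto simp: Simson_point_def)
  qed
  then show "S \<notin> {A, B, C, D}" "angle_sum S A C B D" "angle_sum S B D C A" "\<not> angle_sum S A B C D"
    by auto
qed

theorem theorem32:
  fixes A B C D :: complex
  assumes "nondegenerate_quadrilateral A B C D"
  shows "(\<forall>W. isoptic_point A B C D W \<longrightarrow> Iso_is_parallelogram A B C D W) \<and>
         (\<forall>S. Simson_point A B C D S \<longrightarrow>
            (\<exists>d. Iso A B C D S = (Infinite d, Infinite d, Infinite d, Infinite d)))"
proof (intro conjI allI impI)
  fix W assume "isoptic_point A B C D W"
  from isoptic_point_angle_sums[OF assms this] show "Iso_is_parallelogram A B C D W"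
    by (rule Iso_parallelogram_if_angle_sums[OF assms])
next
  fix S assume S: "Simson_point A B C D S"
  note s = Simson_point_angle_sums[OF assms S]
  have "(A - S) * (C - S) = (B - S) * (D - S)"
    using angle_sum_adjacent[OF s(2,3)] s(1,4) distinct_vertices[OF assms] by auto
  with s(1) show "\<exists>d. Iso A B C D S = (Infinite d, Infinite d, Infinite d, Infinite d)"
    by (rule Iso_infinite_if_Miquel[OF assms])
qed

end
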